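(* Let $p,q,\upsilon,\gamma_1,\dots,\gamma_6,w_1,w_2\in\mathbb{C}$ with $\operatorname{Re}(p)>0$, $\operatorname{Re}(q)>0$, $\operatorname{Re}(\upsilon)>0$, $\gamma_4,\gamma_5,\gamma_6\notin\{0,-1,-2,\dots\}$, and let $a_1<a_2$, $b_1<b_2$ be real. Then the operator $\mathfrak{E}_{\gamma_{4},\gamma_{5},\gamma_{6};p;q;\upsilon;w_{1},w_{2};a_{1}^{+},b_{1}^{+}}^{(\gamma_{1};\gamma_{2};\gamma_{3})}$ is bounded in the space $L((a_1,a_2)\times(b_1,b_2))$, i.e. $$\left\|\mathfrak{E}_{\gamma_{4},\gamma_{5},\gamma_{6};p;q;\upsilon;w_{1},w_{2};a_{1}^{+},b_{1}^{+}}^{(\gamma_{1};\gamma_{2};\gamma_{3})}d\right\|_{1}\le\mathcal{M}\,\|d\|_{1},$$ where the constant $\mathcal{M}$ $(0<\mathcal{M}<\infty)$ is $$\mathcal{M}=(a_{2}-a_{1})^{\operatorname{Re}(p)}(b_{2}-b_{1})^{\operatorname{Re}(q)}\sum_{n=0}^{\infty}\sum_{l=0}^{\infty}\frac{|(\gamma_{1})_{2l}|\,|(\gamma_{2})_{l+n}|\,|(\gamma_{3})_{l}|}{|(\gamma_{4})_{l}|\,|(\gamma_{5})_{l}|\,|(\gamma_{6})_{l}|}\cdot\frac{|w_{1}(a_{2}-a_{1})|^{l}\,\left|\left(w_{2}(b_{2}-b_{1})\right)^{\upsilon}\right|^{n}}{|\Gamma(p+l)|\,|\Gamma(q+\upsilon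 n)|\,(\operatorname{Re}(p)+l)\,(\operatorname{Re}(q)+\operatorname{Re}(\upsilon)n)\,l!\,n!}.$$
   Context: $(a)_n$ is the Pochhammer symbol. The modified bivariate I-Konhauser Mittag-Leffler function is $$E_{\gamma_{4},\gamma_{5},\gamma_{6};p;q;\upsilon}^{(\gamma_{1};\gamma_{2};\gamma_{3})}(z,t)=\sum_{l=0}^{\infty}\sum_{n=0}^{\infty}\frac{(-1)^{l}(\gamma_{1})_{2l}(\gamma_{2})_{l+n}(\gamma_{3})_{l}\,z^{l}t^{\upsilon n}}{(\gamma_{4})_{l}(\gamma_{5})_{l}(\gamma_{6})_{l}\,\Gamma(p+l)\,\Gamma(q+\upsilon n)\,n!\,l!},$$ and, for $s>0$, $(w_2s)^{\upsilon n}$ means $(w_2^{\upsilon})^n s^{\upsilon n}$ with a fixed choice of $w_2^\upsilon$ (and $w_2^{\upsilon}=0$ if $w_2=0$). The double integral operator is $$\left(\mathfrak{E}_{\gamma_{4},\gamma_{5},\gamma_{6};p;q;\upsilon;w_{1},w_{2};a_{1}^{+},b_{1}^{+}}^{(\gamma_{1};\gamma_{2};\gamma_{3})}d\right)(z,t)=\int_{b_1}^{t}\int_{a_1}^{z}(t-y)^{q-1}(z-\xi)^{p-1}E_{\gamma_{4},\gamma_{5},\gamma_{6};p;q;\upsilon}^{(\gamma_{1};\gamma_{2};\gamma_{3})}(w_{1}(z-\xi),w_{2}(t-y))\,d(\xi,y)\,d\xi\,dy.$$ $L((a_1,a_2)\times(b_1,b_2))$ is the space of Lebesgue measurable functions $d$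 with $\|d\|_1=\int_{a_1}^{a_2}\int_{b_1}^{b_2}|d(z,t)|\,dt\,dz<\infty$. *)

theory Defs
  imports "HOL-Analysis.Analysis"
begin

(* c is one of the (in general many) values of the complex power w^v, i.e. c = exp (v * log w)
   for some branch of the logarithm; by convention 0^v = 0. *)
definition cpower_value :: "complex \<Rightarrow> complex \<Rightarrow> complex \<Rightarrow> bool" where
  "cpower_value w v c \<longleftrightarrow>
     (if w = 0 then c = 0 else (\<exists>L. exp L = w \<and> c = exp (v * L)))"

(* konhauser_ML ... z c s is the value of the modified bivariate I-Konhauser Mittag-Leffler
   function at (z, w * s), where s > 0 and c is the chosen value of w^v; accordingly
   (w * s)^(v n) is read as c^n * s^(v n).  Taking c = 1 gives the function at (z, s). *)
definition konhauser_ML ::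
  "complex \<Rightarrow> complex \<Rightarrow> complex \<Rightarrow> complex \<Rightarrow> complex \<Rightarrow> complex \<Rightarrow>
   complex \<Rightarrow> complex \<Rightarrow> complex \<Rightarrow> complex \<Rightarrow> complex \<Rightarrow> real \<Rightarrow> complex" where
  "konhauser_ML g1 g2 g3 g4 g5 g6 p q v z c s =
     (\<Sum>l. \<Sum>n.
        ((-1) ^ l * pochhammer g1 (2 * l) * pochhammer g2 (l + n) * pochhammer g3 l
           * z ^ l * (c ^ n * complex_of_real s powr (v * of_nat n))) /
        (pochhammer g4 l * pochhammer g5 l * pochhammer g6 l
           * Gamma (p + of_nat l) * Gamma (q + v * of_nat n) * fact n * fact l))"

(* The integrand of the double integral operator; c2 is the chosen value of w2^v. *)
definition konhauser_integrand ::
  "complex \<Rightarrow> complex \<Rightarrow> complex \<Rightarrow> complex \<Rightarrow> complex \<Rightarrow> complex \<Rightarrow>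
   complex \<Rightarrow> complex \<Rightarrow> complex \<Rightarrow> complex \<Rightarrow> complex \<Rightarrow>
   (real \<times> real \<Rightarrow> complex) \<Rightarrow> real \<Rightarrow> real \<Rightarrow> real \<times> real \<Rightarrow> complex" where
  "konhauser_integrand g1 g2 g3 g4 g5 g6 p q v w1 c2 d z t = (\<lambda>(\<xi>, y).
     complex_of_real (t - y) powr (q - 1) * complex_of_real (z - \<xi>) powr (p - 1)
       * konhauser_ML g1 g2 g3 g4 g5 g6 p q v (w1 * complex_of_real (z - \<xi>)) c2 (t - y)
       * d (\<xi>, y))"

definition konhauser_operator ::
  "complex \<Rightarrow> complex \<Rightarrow> complex \<Rightarrow> complex \<Rightarrow> complex \<Rightarrow> complex \<Rightarrow>
   complex \<Rightarrow> complex \<Rightarrow> complex \<Rightarrow> complex \<Rightarrow> complex \<Rightarrow> real \<Rightarrow> real \<Rightarrow>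
   (real \<times> real \<Rightarrow> complex) \<Rightarrow> real \<times> real \<Rightarrow> complex" where
  "konhauser_operator g1 g2 g3 g4 g5 g6 p q v w1 c2 a1 b1 d = (\<lambda>(z, t).
     (LINT y:{b1<..<t}|lebesgue. (LINT \<xi>:{a1<..<z}|lebesgue.
        konhauser_integrand g1 g2 g3 g4 g5 g6 p q v w1 c2 d z t (\<xi>, y))))"

definition norm_L1 ::
  "real \<Rightarrow> real \<Rightarrow> real \<Rightarrow> real \<Rightarrow> (real \<times> real \<Rightarrow> complex) \<Rightarrow> ennreal" where
  "norm_L1 a1 a2 b1 b2 d =
     (\<integral>\<^sup>+z\<in>{a1<..<a2}. (\<integral>\<^sup>+t\<in>{b1<..<b2}. ennreal (norm (d (z, t))) \<partial>lebesgue) \<partial>lebesgue)"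

(* Functions are total in HOL; only their values on the open rectangle matter here. *)
definition space_L1 ::
  "real \<Rightarrow> real \<Rightarrow> real \<Rightarrow> real \<Rightarrow> (real \<times> real \<Rightarrow> complex) set" where
  "space_L1 a1 a2 b1 b2 =
     {d. d \<in> borel_measurable (lebesgue_on ({a1<..<a2} \<times> {b1<..<b2}))
         \<and> norm_L1 a1 a2 b1 b2 d < \<infinity>}"

(* The constant is a sum of nonnegative terms in [0, \<infinity>], so that its finiteness is a genuine
   assertion about convergence of the double series. *)
definition konhauser_bound ::
  "complex \<Rightarrow> complex \<Rightarrow> complex \<Rightarrow> complex \<Rightarrow> complex \<Rightarrow> complex \<Rightarrow>
   complex \<Rightarrow> complex \<Rightarrow> complex \<Rightarrow> complex \<Rightarrow> complex \<Rightarrow>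
   real \<Rightarrow> real \<Rightarrow> real \<Rightarrow> real \<Rightarrow> ennreal" where
  "konhauser_bound g1 g2 g3 g4 g5 g6 p q v w1 c2 a1 a2 b1 b2 =
     ennreal ((a2 - a1) powr Re p * (b2 - b1) powr Re q) *
     (\<Sum>n. \<Sum>l. ennreal (
        (norm (pochhammer g1 (2 * l)) * norm (pochhammer g2 (l + n)) * norm (pochhammer g3 l)) /
        (norm (pochhammer g4 l) * norm (pochhammer g5 l) * norm (pochhammer g6 l)) *
        ((norm (w1 * complex_of_real (a2 - a1)) ^ l *
          norm (c2 * complex_of_real (b2 - b1) powr v) ^ n) /
         (norm (Gamma (p + of_nat l)) * norm (Gamma (q + v * of_nat n)) *
          (Re p + real l) * (Re q + Re v * real n) * fact l * fact n))))"

end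

theory Submission
  imports Defs "HOL-Complex_Analysis.Cauchy_Integral_Theorem"
begin

text \<open>
The operator is a convolution, truncated to the rectangle, with the kernel
\<open>k(x, s) = s powr (q - 1) * x powr (p - 1) * E(w\<^sub>1x, w\<^sub>2s)\<close>. Tonelli's theorem and the translation invariance of
Lebesgue measure therefore give \<open>\<parallel>k \<star> d\<parallel>\<^sub>1 \<le> \<parallel>k\<parallel>\<^sub>1 \<parallel>d\<parallel>\<^sub>1\<close>, where \<open>\<parallel>k\<parallel>\<^sub>1\<close> is taken over
\<open>(0, a\<^sub>2 - a\<^sub>1) \<times> (0, b\<^sub>2 - b\<^sub>1)\<close> (\<open>volterra_convolution_L1\<close>). By the triangle inequality, \<open>\<bar>k\<bar>\<close> is at most the sum of
the norms of the terms of its series. These are multiples of powers of \<open>x\<close> and \<open>s\<close>, and their integrals sum up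
exactly to the constant \<open>M\<close> (\<open>konhauser_kernel_L1_le\<close>). This step takes place in \<open>[0, \<infinity>]\<close>, so that it
can precede the question of convergence.

What remains is \<open>M < \<infinity>\<close> (\<open>konhauser_bound_finite\<close>). Pochhammer symbols are factorials up to
geometric factors, and after cancellation of factorials the double series is dominated by the product of the
series of \<open>K\<^sup>l / l!\<close> and that of \<open>L\<^sup>n / \<bar>\<Gamma>(q + \<upsilon>n)\<bar>\<close>. For the second one, \<open>1/\<Gamma>\<close> must decay
superexponentially along \<open>q + \<upsilon>n\<close>, although \<open>\<upsilon>\<close> is complex. These points lie in a sector around the
positive axis, on which Gauss's product formula bounds \<open>1 / \<bar>\<Gamma>(z)\<bar>\<close> by \<open>1 / \<Gamma>(Re z)\<close> up to
an exponential factor (\<open>norm_rGamma_le_rGamma_Re\<close>), while \<open>\<Gamma>\<close> on the positive axis grows faster than any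
exponential (\<open>Gamma_real_ge\<close>).
\<close>

section \<open>Decay of the reciprocal Gamma function in a sector\<close>

lemma sum_inverse_square_shift_le:
  fixes x :: real
  assumes "x > 0"
  shows "(\<Sum>k\<le>N. 1 / (x + real k)\<^sup>2) \<le> 1 / x\<^sup>2 + 1 / x"
proof -
  have "(\<Sum>k\<le>N. 1 / (x + real k)\<^sup>2) \<le> 1 / x\<^sup>2 + 1 / x - 1 / (x + real N)"
  proof (induction N)
    case 0
    then show ?case by simp
  next
    case (Suc N)
    define u where "u = x + real N"
    have u: "u > 0" using assms by (simp add: u_def)
    have "1 / (u + 1)\<^sup>2 \<le> 1 / (u * (u + 1))"
      using u by (intro divide_left_mono mult_pos_pos) (auto simp: power2_eq_square)
    also have "\<dots> = 1 / u - 1 / (u + 1)" using u by (simp add: field_simps)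
    finally have "1 / (x + real (Suc N))\<^sup>2 \<le> 1 / (x + real N) - 1 / (x + real (Suc N))"
      by (simp add: u_def add_ac)
    with Suc show ?case by simp
  qed
  also have "\<dots> \<le> 1 / x\<^sup>2 + 1 / x" using assms by simp
  finally show ?thesis .
qed

text \<open>Each factor of the Pochhammer product satisfies
\<open>\<bar>z + k\<bar> = (x + k) * sqrt (1 + y\<^sup>2 / (x + k)\<^sup>2) \<le> (x + k) * exp (y\<^sup>2 / (2 * (x + k)\<^sup>2))\<close> with \<open>x = Re z\<close>
and \<open>y = Im z\<close>. In a sector \<open>\<bar>y\<bar> \<le> c * x\<close> the exponents sum to at most \<open>c\<^sup>2 * (1 + x) / 2\<close>, uniformly in
the number of factors, so the estimate survives the limit in Gauss's product for the Gamma function.\<close>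
lemma norm_pochhammer_le_pochhammer_Re:
  assumes "Re z > 0" and "\<bar>Im z\<bar> \<le> c * Re z"
  shows "norm (pochhammer z (Suc N)) \<le> pochhammer (Re z) (Suc N) * exp (c\<^sup>2 * (1 + Re z) / 2)"
proof -
  define x y where "x = Re z" and "y = Im z"
  have x: "x > 0" using assms by (simp add: x_def)
  have factor: "norm (z + of_nat k) \<le> (x + real k) * exp (y\<^sup>2 / 2 * (1 / (x + real k)\<^sup>2))" for k
  proof -
    define u where "u = x + real k"
    have u: "u > 0" using x by (simp add: u_def)
    have "(norm (z + of_nat k))\<^sup>2 = u\<^sup>2 * (1 + y\<^sup>2 / u\<^sup>2)"
      using u by (simp add: cmod_power2 x_def y_def u_def field_simps)
    also have "\<dots> \<le> u\<^sup>2 * exp (y\<^sup>2 / u\<^sup>2)"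
      by (intro mult_left_mono exp_ge_add_one_self) auto
    also have "\<dots> = (u * exp (y\<^sup>2 / 2 * (1 / u\<^sup>2)))\<^sup>2"
      by (simp add: power_mult_distrib flip: exp_double)
    finally have "norm (z + of_nat k) \<le> u * exp (y\<^sup>2 / 2 * (1 / u\<^sup>2))"
      by (rule power2_le_imp_le) (use u in simp)
    thus ?thesis by (simp add: u_def)
  qed
  have "norm (pochhammer z (Suc N)) = (\<Prod>k\<le>N. norm (z + of_nat k))"
    by (simp add: pochhammer_Suc_prod prod_norm atMost_atLeast0)
  also have "\<dots> \<le> (\<Prod>k\<le>N. (x + real k) * exp (y\<^sup>2 / 2 * (1 / (x + real k)\<^sup>2)))"
    by (intro prod_mono) (use factor in auto)
  also have "\<dots> = pochhammer x (Suc N) * exp (y\<^sup>2 / 2 * (\<Sum>k\<le>N. 1 / (x + real k)\<^sup>2))"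
    by (simp add: pochhammer_Suc_prod prod.distrib exp_sum sum_distrib_left atMost_atLeast0)
  also have "\<dots> \<le> pochhammer x (Suc N) * exp (c\<^sup>2 * (1 + x) / 2)"
  proof (intro mult_left_mono)
    have "y\<^sup>2 \<le> (c * x)\<^sup>2"
      using assms by (intro abs_le_square_iff[THEN iffD1]) (auto simp: x_def y_def)
    hence "y\<^sup>2 / 2 * (\<Sum>k\<le>N. 1 / (x + real k)\<^sup>2) \<le> (c * x)\<^sup>2 / 2 * (1 / x\<^sup>2 + 1 / x)"
      using x by (intro mult_mono sum_inverse_square_shift_le divide_right_mono sum_nonneg) auto
    also have "\<dots> = c\<^sup>2 * (1 + x) / 2" using x by (simp add: field_simps power2_eq_square)
    finally show "exp (y\<^sup>2 / 2 * (\<Sum>k\<le>N. 1 / (x + real k)\<^sup>2)) \<le> exp (c\<^sup>2 * (1 + x) / 2)" by simp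
    show "0 \<le> pochhammer x (Suc N)" using x by (intro pochhammer_nonneg)
  qed
  finally show ?thesis by (simp add: x_def)
qed

lemma norm_rGamma_le_rGamma_Re:
  assumes "Re z > 0" and "\<bar>Im z\<bar> \<le> c * Re z"
  shows "norm (rGamma z) \<le> rGamma (Re z) * exp (c\<^sup>2 * (1 + Re z) / 2)"
proof (rule LIMSEQ_le)
  show "(\<lambda>N. norm (rGamma_series z N)) \<longlonglongrightarrow> norm (rGamma z)"
    by (intro tendsto_norm rGamma_series_LIMSEQ)
  show "(\<lambda>N. rGamma_series (Re z) N * exp (c\<^sup>2 * (1 + Re z) / 2))
          \<longlonglongrightarrow> rGamma (Re z) * exp (c\<^sup>2 * (1 + Re z) / 2)"
    by (intro tendsto_mult_right rGamma_series_LIMSEQ)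
  have "norm (rGamma_series z N) \<le> rGamma_series (Re z) N * exp (c\<^sup>2 * (1 + Re z) / 2)" for N
    using divide_right_mono[OF norm_pochhammer_le_pochhammer_Re[OF assms, of N],
        of "fact N * exp (Re z * ln (real N))"]
    by (simp add: rGamma_series_def norm_divide norm_mult)
  thus "\<exists>N0. \<forall>N\<ge>N0. norm (rGamma_series z N) \<le> rGamma_series (Re z) N * exp (c\<^sup>2 * (1 + Re z) / 2)"
    by blast
qed

text \<open>Only the tail \<open>t \<ge> T\<close> of Euler's integral for \<open>\<Gamma>(x + 1)\<close> is kept, and there \<open>t powr x \<ge> T powr x\<close>. As \<open>T\<close> is
arbitrary, this makes \<open>\<Gamma>(x)\<close> grow faster than every exponential.\<close>
lemma Gamma_real_ge:
  fixes x T :: real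
  assumes "x > 0" "T > 0"
  shows "T powr x * exp (- T) \<le> x * Gamma x"
proof -
  have "((\<lambda>t. T powr x * exp (- 1 * t)) has_integral T powr x * (exp (- 1 * T) / 1)) {T..}"
    by (intro has_integral_mult_right has_integral_exp_minus_to_infinity) auto
  hence 1: "((\<lambda>t. T powr x * exp (- t)) has_integral T powr x * exp (- T)) {T..}" by simp
  have 2: "((\<lambda>t. t powr x / exp t) has_integral Gamma (x + 1)) {0..}"
    using Gamma_integral_real[of "x + 1"] assms by simp
  have 3: "((\<lambda>t. if t \<in> {T..} then T powr x * exp (- t) else 0) has_integral T powr x * exp (- T)) {0..}"
    using 1 assms by (subst has_integral_restrict) auto
  have "T powr x * exp (- T) \<le> Gamma (x + 1)"
    by (rule has_integral_le[OF 3 2])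
      (use assms in \<open>auto simp: exp_minus field_simps intro!: powr_mono2\<close>)
  also have "Gamma (x + 1) = x * Gamma x"
    using assms by (intro Gamma_plus1) (auto elim!: nonpos_Ints_cases)
  finally show ?thesis .
qed

text \<open>Passing from \<open>Re z\<close> to \<open>z\<close> costs a factor that is only exponential in \<open>Re z\<close>, and the decay
of \<open>1/\<Gamma>\<close> on the positive axis beats every exponential. The arguments \<open>q + \<upsilon>n\<close> with complex
\<open>\<upsilon>\<close> lie in one such sector, which is how the lemma is used.\<close>
lemma rGamma_sector_superexponential_decay:
  fixes c r :: real
  assumes "r > 0"
  obtains C where "C > 0"
    "\<And>z. \<lbrakk>Re z > 0; \<bar>Im z\<bar> \<le> c * Re z\<rbrakk> \<Longrightarrow> norm (rGamma z) \<le> C * r powr Re z"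
proof -
  define M where "M = exp (c\<^sup>2 / 2)"
  \<comment> \<open>this truncation point turns the final base \<open>exp 1 * M / T\<close> into \<open>r\<close>\<close>
  define T where "T = exp 1 * M / r"
  have pos: "M > 0" "T > 0" using assms by (auto simp: M_def T_def)
  show ?thesis
  proof (rule that[of "exp T * M"])
    show "exp T * M > 0" using pos by simp
    fix z assume z: "Re z > 0" "\<bar>Im z\<bar> \<le> c * Re z"
    define x where "x = Re z"
    have x: "x > 0" using z by (simp add: x_def)
    have "T powr x * exp (- T) * rGamma x \<le> x * Gamma x * rGamma x"
      using x pos by (intro mult_right_mono Gamma_real_ge) (auto simp: rGamma_inverse_Gamma)
    also have "\<dots> = x"
      using Gamma_real_pos[OF x] by (simp add: rGamma_inverse_Gamma)
    also have "\<dots> \<le> exp x" using exp_ge_add_one_self[of x] by linarith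
    finally have "rGamma x \<le> exp T * exp x / T powr x"
      using pos by (simp add: exp_minus field_simps)
    hence "rGamma x * exp (c\<^sup>2 * (1 + x) / 2) \<le> exp T * exp x / T powr x * exp (c\<^sup>2 * (1 + x) / 2)"
      by (intro mult_right_mono) auto
    also have M: "exp (c\<^sup>2 * (1 + x) / 2) = M * M powr x"
      by (simp add: M_def powr_def field_simps flip: exp_add)
    also have "exp T * exp x / T powr x * (M * M powr x) = exp T * M * r powr x"
      using assms pos by (simp add: T_def powr_divide powr_mult) (simp add: powr_def)
    finally show "norm (rGamma z) \<le> exp T * M * r powr Re z"
      using norm_rGamma_le_rGamma_Re[OF z] by (simp add: x_def M[unfolded x_def])
  qed
qed

lemma summable_power_times_rGamma:
  fixes q v :: complex and K :: real
  assumes "Re q > 0" "Re v > 0" "K \<ge> 0"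
  shows "summable (\<lambda>n. K ^ n * norm (rGamma (q + v * of_nat n)))"
proof -
  \<comment> \<open>the sector of slope \<open>c\<close> is a convex cone containing \<open>q\<close> and \<open>v\<close>, hence all \<open>q + v * n\<close>\<close>
  define c where "c = max (\<bar>Im q\<bar> / Re q) (\<bar>Im v\<bar> / Re v)"
  \<comment> \<open>chosen such that the terms decay like \<open>(K / (2 * (K + 1))) ^ n\<close>\<close>
  define r where "r = (1 / (2 * (K + 1))) powr (1 / Re v)"
  have r: "r > 0" "r powr Re v = 1 / (2 * (K + 1))"
    using assms by (auto simp: r_def powr_powr)
  obtain C where C: "C > 0"
    "\<And>z. \<lbrakk>Re z > 0; \<bar>Im z\<bar> \<le> c * Re z\<rbrakk> \<Longrightarrow> norm (rGamma z) \<le> C * r powr Re z"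
    using rGamma_sector_superexponential_decay[OF r(1)] by metis
  have bound: "norm (rGamma (q + v * of_nat n)) \<le> C * r powr Re q * (1 / (2 * (K + 1))) ^ n" for n
  proof -
    have "\<bar>Im q\<bar> \<le> c * Re q" "\<bar>Im v\<bar> \<le> c * Re v"
      using assms by (simp_all add: c_def flip: pos_divide_le_eq)
    hence "\<bar>Im q\<bar> + real n * \<bar>Im v\<bar> \<le> c * Re q + real n * (c * Re v)"
      by (intro add_mono mult_left_mono) auto
    moreover have "\<bar>Im q + Im v * real n\<bar> \<le> \<bar>Im q\<bar> + real n * \<bar>Im v\<bar>"
      by (rule order.trans[OF abs_triangle_ineq]) (simp add: abs_mult mult_ac)
    ultimately have "\<bar>Im (q + v * of_nat n)\<bar> \<le> c * Re (q + v * of_nat n)"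
      by (simp add: algebra_simps)
    moreover have "Re (q + v * of_nat n) > 0" using assms by (simp add: add_pos_nonneg)
    ultimately have "norm (rGamma (q + v * of_nat n)) \<le> C * r powr (Re q + Re v * real n)"
      using C(2)[of "q + v * of_nat n"] by simp
    also have "r powr (Re q + Re v * real n) = r powr Re q * (r powr Re v) ^ n"
      using r(1) by (simp add: powr_add powr_powr flip: powr_realpow)
    finally show ?thesis using r(2) by (simp add: mult_ac)
  qed
  show ?thesis
  proof (rule summable_comparison_test'[where N = 0])
    have "\<bar>K / (2 * (K + 1))\<bar> < 1" using assms by simp
    thus "summable (\<lambda>n. C * r powr Re q * (K / (2 * (K + 1))) ^ n)"
      by (intro summable_mult summable_geometric) simp
    fix n :: nat
    have "K ^ n * norm (rGamma (q + v * of_nat n)) \<le> K ^ n * (C * r powr Re q * (1 / (2 * (K + 1))) ^ n)"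
      using assms by (intro mult_left_mono bound) auto
    also have "\<dots> = C * r powr Re q * (K / (2 * (K + 1))) ^ n"
      by (simp add: power_divide)
    finally show "norm (K ^ n * norm (rGamma (q + v * of_nat n))) \<le> C * r powr Re q * (K / (2 * (K + 1))) ^ n"
      using assms by simp
  qed
qed

section \<open>Convergence of the double series\<close>

lemma norm_pochhammer_le:
  fixes g :: complex
  shows "norm (pochhammer g m) \<le> (norm g + 1) ^ m * fact m"
proof (induction m)
  case (Suc m)
  have "norm (g + of_nat m) \<le> norm g + real m"
    using norm_triangle_ineq[of g "of_nat m"] by simp
  also have "\<dots> \<le> (norm g + 1) * real (Suc m)" by (simp add: algebra_simps)
  finally have "norm (pochhammer g m) * norm (g + of_nat m) \<le>
      ((norm g + 1) ^ m * fact m) * ((norm g + 1) * real (Suc m))"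
    using Suc by (intro mult_mono) auto
  thus ?case by (simp add: pochhammer_Suc norm_mult mult_ac)
qed simp

text \<open>The quotient \<open>\<bar>g + k\<bar> / (k + 1)\<close> tends to \<open>1\<close> as \<open>k\<close> grows and never vanishes, hence it is bounded below by a positive
constant. Together with the upper bound above this says that a Pochhammer symbol is a factorial up to
geometric factors.\<close>
lemma norm_pochhammer_ge:
  fixes g :: complex
  assumes "g \<notin> \<int>\<^sub>\<le>\<^sub>0"
  obtains c where "c > 0" "\<And>m. c ^ m * fact m \<le> norm (pochhammer g m)"
proof -
  \<comment> \<open>from \<open>k = N\<close> on, the quotient \<open>norm (g + k) / (k + 1)\<close> is at least \<open>1/2\<close>\<close>
  define N where "N = nat \<lceil>2 * (norm g + 1)\<rceil>"
  define c where "c = Min (insert (1/2) ((\<lambda>k. norm (g + of_nat k) / real (Suc k)) ` {..<N}))"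
  have nz: "g + of_nat k \<noteq> 0" for k
    using assms by (metis add_eq_0_iff2 minus_of_nat_in_nonpos_Ints)
  have c: "c > 0" unfolding c_def by (subst Min_gr_iff) (auto simp: nz simp del: of_nat_Suc)
  have factor: "c * real (Suc k) \<le> norm (g + of_nat k)" for k
  proof (cases "k < N")
    case True
    hence "c \<le> norm (g + of_nat k) / real (Suc k)" by (auto simp: c_def intro!: Min_le)
    thus ?thesis by (simp add: field_simps)
  next
    case False
    hence "2 * (norm g + 1) \<le> real k" by (simp add: N_def) linarith
    hence "1/2 * real (Suc k) \<le> real k - norm g" by simp
    also have "\<dots> \<le> norm (g + of_nat k)"
      using norm_triangle_ineq4[of "g + of_nat k" g] by simp
    finally have "1/2 * real (Suc k) \<le> norm (g + of_nat k)" .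
    moreover have "c \<le> 1/2" unfolding c_def by (intro Min_le) auto
    ultimately show ?thesis
      using mult_right_mono[of c "1/2" "real (Suc k)"] by linarith
  qed
  have "c ^ m * fact m \<le> norm (pochhammer g m)" for m
  proof (induction m)
    case (Suc m)
    have "(c ^ m * fact m) * (c * real (Suc m)) \<le> norm (pochhammer g m) * norm (g + of_nat m)"
      using Suc factor[of m] c by (intro mult_mono) auto
    thus ?case by (simp add: pochhammer_Suc norm_mult mult_ac)
  qed simp
  with c that show ?thesis by blast
qed

lemma fact_add_le: "fact (l + n) \<le> 2 ^ (l + n) * fact l * (fact n :: real)"
proof -
  have "fact (l + n) = real (l + n choose l) * (fact l * fact n)"
    by (simp add: binomial_fact)
  also have "\<dots> \<le> real (2 ^ (l + n)) * (fact l * fact n)"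
    using binomial_le_pow2[of "l + n" l] by (intro mult_right_mono) (simp_all only: of_nat_le_iff, simp)
  finally show ?thesis by (simp add: mult.assoc)
qed

text \<open>Up to factors geometric in \<open>l\<close> and \<open>n\<close>, the numerator of the general term is at most \<open>l!\<^sup>2 (l! n!) l!\<close>
and the denominator at least \<open>l!\<^sup>3 l! \<bar>\<Gamma>(q + \<upsilon>n)\<bar> l! n!\<close>. So the double series is dominated by the
product of an exponential series in \<open>l\<close> and the series over \<open>n\<close> of \<open>L\<^sup>n / \<bar>\<Gamma>(q + \<upsilon>n)\<bar>\<close>.\<close>
lemma konhauser_bound_finite:
  fixes p q v g1 g2 g3 g4 g5 g6 w1 c2 :: complex
  assumes "Re p > 0" "Re q > 0" "Re v > 0" "g4 \<notin> \<int>\<^sub>\<le>\<^sub>0" "g5 \<notin> \<int>\<^sub>\<le>\<^sub>0" "g6 \<notin> \<int>\<^sub>\<le>\<^sub>0"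
  shows "konhauser_bound g1 g2 g3 g4 g5 g6 p q v w1 c2 a1 a2 b1 b2 < \<infinity>"
proof -
  have p: "p \<notin> \<int>\<^sub>\<le>\<^sub>0" using assms(1) by (auto elim!: nonpos_Ints_cases)
  obtain c4 where c4: "c4 > 0" "\<And>m. c4 ^ m * fact m \<le> norm (pochhammer g4 m)"
    using norm_pochhammer_ge[OF assms(4)] by metis
  obtain c5 where c5: "c5 > 0" "\<And>m. c5 ^ m * fact m \<le> norm (pochhammer g5 m)"
    using norm_pochhammer_ge[OF assms(5)] by metis
  obtain c6 where c6: "c6 > 0" "\<And>m. c6 ^ m * fact m \<le> norm (pochhammer g6 m)"
    using norm_pochhammer_ge[OF assms(6)] by metis
  obtain cp where cp: "cp > 0" "\<And>m. cp ^ m * fact m \<le> norm (pochhammer p m)"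
    using norm_pochhammer_ge[OF p] by metis
  define G1 G2 G3 where "G1 = norm g1 + 1" and "G2 = norm g2 + 1" and "G3 = norm g3 + 1"
  define X Y where "X = norm (w1 * complex_of_real (a2 - a1))"
    and "Y = norm (c2 * complex_of_real (b2 - b1) powr v)"
  have nonneg: "G1 \<ge> 0" "G2 \<ge> 0" "G3 \<ge> 0" "X \<ge> 0" "Y \<ge> 0"
    by (auto simp: G1_def G2_def G3_def X_def Y_def)
  define K where "K = G1\<^sup>2 * 4 * G2 * 2 * G3 * X / (c4 * c5 * c6 * cp)"
  define A where "A = (\<lambda>l. inverse (norm (Gamma p) * Re p * Re q) * (inverse (fact l) * K ^ l))"
  define B where "B = (\<lambda>n. (G2 * 2 * Y) ^ n * norm (rGamma (q + v * of_nat n)))"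
  define t where "t = (\<lambda>n l. (norm (pochhammer g1 (2 * l)) * norm (pochhammer g2 (l + n)) * norm (pochhammer g3 l)) /
        (norm (pochhammer g4 l) * norm (pochhammer g5 l) * norm (pochhammer g6 l)) *
        ((X ^ l * Y ^ n) /
         (norm (Gamma (p + of_nat l)) * norm (Gamma (q + v * of_nat n)) *
          (Re p + real l) * (Re q + Re v * real n) * fact l * fact n)))"
  have K: "K \<ge> 0" using nonneg c4 c5 c6 cp by (simp add: K_def)
  have Gp: "norm (Gamma p) > 0" using p by (simp add: Gamma_eq_zero_iff)
  have A_nonneg: "A l \<ge> 0" for l using K Gp assms by (simp add: A_def)
  have B_nonneg: "B n \<ge> 0" for n using nonneg by (simp add: B_def)
  have t_le: "t n l \<le> B n * A l" for n l
  proof -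
    have Gq: "norm (Gamma (q + v * of_nat n)) > 0"
    proof -
      have "Re (q + v * of_nat n) > 0" using assms by (simp add: add_pos_nonneg)
      hence "q + v * of_nat n \<notin> \<int>\<^sub>\<le>\<^sub>0"
        by (metis Re_complex_of_real nonpos_Ints_subset_nonpos_Reals complex_nonpos_Reals_iff not_le subsetD)
      thus ?thesis by (simp add: Gamma_eq_zero_iff)
    qed
    have n1: "norm (pochhammer g1 (2 * l)) \<le> (G1\<^sup>2 * 4) ^ l * (fact l)\<^sup>2"
    proof -
      have "norm (pochhammer g1 (2 * l)) \<le> G1 ^ (2 * l) * fact (2 * l)"
        using norm_pochhammer_le[of g1 "2 * l"] by (simp add: G1_def)
      also have "\<dots> \<le> G1 ^ (2 * l) * (2 ^ (l + l) * fact l * fact l)"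
        using nonneg fact_add_le[of l l] by (intro mult_left_mono) (auto simp: mult_2)
      also have "\<dots> = (G1\<^sup>2 * 4) ^ l * (fact l)\<^sup>2"
        by (simp add: power_mult_distrib power2_eq_square power_add power_mult flip: mult_2)
      finally show ?thesis .
    qed
    have n2: "norm (pochhammer g2 (l + n)) \<le> (G2 * 2) ^ (l + n) * (fact l * fact n)"
    proof -
      have "norm (pochhammer g2 (l + n)) \<le> G2 ^ (l + n) * fact (l + n)"
        using norm_pochhammer_le[of g2 "l + n"] by (simp add: G2_def)
      also have "\<dots> \<le> G2 ^ (l + n) * (2 ^ (l + n) * fact l * fact n)"
        using nonneg by (intro mult_left_mono fact_add_le) auto
      finally show ?thesis by (simp add: power_mult_distrib mult_ac)
    qed
    have n3: "norm (pochhammer g3 l) \<le> G3 ^ l * fact l"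
      using norm_pochhammer_le[of g3 l] by (simp add: G3_def)
    have dp: "norm (Gamma p) * (cp ^ l * fact l) \<le> norm (Gamma (p + of_nat l))"
    proof -
      have "Gamma (p + of_nat l) = Gamma p * pochhammer p l"
        using pochhammer_Gamma[OF p, of l] Gp by simp
      thus ?thesis using cp(2)[of l] by (simp add: norm_mult mult_left_mono)
    qed
    have num: "norm (pochhammer g1 (2 * l)) * norm (pochhammer g2 (l + n)) * norm (pochhammer g3 l)
      \<le> ((G1\<^sup>2 * 4) ^ l * (fact l)\<^sup>2) * ((G2 * 2) ^ (l + n) * (fact l * fact n)) * (G3 ^ l * fact l)"
      using nonneg by (intro mult_mono n1 n2 n3) auto
    have den1: "(c4 ^ l * fact l) * (c5 ^ l * fact l) * (c6 ^ l * fact l)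
      \<le> norm (pochhammer g4 l) * norm (pochhammer g5 l) * norm (pochhammer g6 l)"
      using c4 c5 c6 by (intro mult_mono) (auto simp: less_imp_le)
    have den2: "norm (Gamma p) * (cp ^ l * fact l) * norm (Gamma (q + v * of_nat n)) * Re p * Re q * fact l * fact n
      \<le> norm (Gamma (p + of_nat l)) * norm (Gamma (q + v * of_nat n)) *
          (Re p + real l) * (Re q + Re v * real n) * fact l * fact n"
      using assms cp by (intro mult_mono dp) (auto simp: less_imp_le)
    have "t n l \<le> ((G1\<^sup>2 * 4) ^ l * (fact l)\<^sup>2) * ((G2 * 2) ^ (l + n) * (fact l * fact n)) * (G3 ^ l * fact l)
       / ((c4 ^ l * fact l) * (c5 ^ l * fact l) * (c6 ^ l * fact l))
       * ((X ^ l * Y ^ n) / (norm (Gamma p) * (cp ^ l * fact l) * norm (Gamma (q + v * of_nat n)) * Re p * Re q * fact l * fact n))"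
      unfolding t_def
      using nonneg c4(1) c5(1) c6(1) cp(1) assms(1-3) Gp Gq
      by (intro mult_mono frac_le num den1 den2 mult_pos_pos mult_nonneg_nonneg divide_nonneg_nonneg) auto
    also have "\<dots> = B n * A l"
    proof -
      \<comment> \<open>the cancellation of the factorials \<open>F = l!\<close> and \<open>N = n!\<close>, all powers and norms being opaque\<close>
      have alg: "(a * F\<^sup>2) * ((b1 * b2) * (F * N)) * (g * F) / ((d4 * F) * (d5 * F) * (d6 * F)) *
          ((x * y) / (G * (dp * F) * H * rp * rq * F * N)) =
          (b2 * y) * inverse H * (inverse (G * rp * rq) * (inverse F * (a * b1 * g * x / (d4 * d5 * d6 * dp))))"
        if "F \<noteq> 0" "N \<noteq> 0" "d4 \<noteq> 0" "d5 \<noteq> 0" "d6 \<noteq> 0" "dp \<noteq> 0" "G \<noteq> 0" "H \<noteq> 0" "rp \<noteq> 0" "rq \<noteq> 0"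
        for a b1 b2 F N g d4 d5 d6 dp x y G H rp rq :: real
        using that by (simp add: field_simps power2_eq_square)
      have K_pow: "K ^ l = (G1\<^sup>2 * 4) ^ l * (G2 * 2) ^ l * G3 ^ l * X ^ l / (c4 ^ l * c5 ^ l * c6 ^ l * cp ^ l)"
        unfolding K_def power_divide power_mult_distrib by (simp only: mult_ac)
      show ?thesis
        unfolding A_def B_def K_pow rGamma_inverse_Gamma norm_inverse power_add
          power_mult_distrib[of "G2 * 2" Y]
        by (rule alg) (use c4(1) c5(1) c6(1) cp(1) assms(1,2) Gp Gq in auto)
    qed
    finally show ?thesis .
  qed
  have sumA: "summable A" unfolding A_def by (intro summable_mult summable_exp)
  have sumB: "summable B"
    unfolding B_def using assms nonneg by (intro summable_power_times_rGamma) auto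
  have "(\<Sum>n. \<Sum>l. ennreal (t n l)) \<le> (\<Sum>n. \<Sum>l. ennreal (B n) * ennreal (A l))"
    using t_le A_nonneg B_nonneg by (intro suminf_le summableI) (auto simp: ennreal_leI simp flip: ennreal_mult')
  also have "\<dots> = (\<Sum>n. ennreal (B n)) * (\<Sum>l. ennreal (A l))"
    by (simp add: ennreal_suminf_cmult ennreal_suminf_multc)
  also have "\<dots> < \<infinity>"
    using ennreal_suminf_neq_top[OF sumA A_nonneg] ennreal_suminf_neq_top[OF sumB B_nonneg]
    by (simp add: ennreal_mult_less_top less_top)
  finally show ?thesis
    by (simp add: konhauser_bound_def t_def X_def Y_def ennreal_mult_less_top)
qed

lemma konhauser_bound_pos:
  fixes p q v g1 g2 g3 g4 g5 g6 w1 c2 :: complex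
  assumes "Re p > 0" "Re q > 0" "a1 < a2" "b1 < b2"
  shows "0 < konhauser_bound g1 g2 g3 g4 g5 g6 p q v w1 c2 a1 a2 b1 b2"
proof -
  define f where "f = (\<lambda>n l. ennreal (
        (norm (pochhammer g1 (2 * l)) * norm (pochhammer g2 (l + n)) * norm (pochhammer g3 l)) /
        (norm (pochhammer g4 l) * norm (pochhammer g5 l) * norm (pochhammer g6 l)) *
        ((norm (w1 * complex_of_real (a2 - a1)) ^ l *
          norm (c2 * complex_of_real (b2 - b1) powr v) ^ n) /
         (norm (Gamma (p + of_nat l)) * norm (Gamma (q + v * of_nat n)) *
          (Re p + real l) * (Re q + Re v * real n) * fact l * fact n))))"
  have "p \<notin> \<int>\<^sub>\<le>\<^sub>0" "q \<notin> \<int>\<^sub>\<le>\<^sub>0" using assms by (auto elim!: nonpos_Ints_cases)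
  hence "0 < f 0 0" using assms by (simp add: f_def Gamma_eq_zero_iff)
  also have "f 0 0 \<le> (\<Sum>l. f 0 l)" using sum_le_suminf[of "f 0" "{0}"] by simp
  also have "\<dots> \<le> (\<Sum>n. \<Sum>l. f n l)" using sum_le_suminf[of "\<lambda>n. \<Sum>l. f n l" "{0}"] by simp
  finally show ?thesis
    using assms by (simp add: konhauser_bound_def f_def ennreal_zero_less_mult_iff)
qed

section \<open>Truncated convolutions on the space of integrable functions\<close>

text \<open>The set where \<open>f\<close> and \<open>g\<close> differ is contained in a null set, all of whose subsets are measurable for the
completed measure. This is what lets a Lebesgue measurable integrand be exchanged for a Borel one inside
Bochner integrals, whose congruence rules ask for measurability on both sides.\<close>
lemma measurable_completion_cong_AE:
  assumes g: "g \<in> M \<rightarrow>\<^sub>M N" and f: "\<And>x. x \<in> space M \<Longrightarrow> f x \<in> space N"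
    and ae: "AE x in M. f x = g x"
  shows "f \<in> completion M \<rightarrow>\<^sub>M N"
proof (rule measurableI)
  fix A assume A: "A \<in> sets N"
  have gA: "g -` A \<inter> space (completion M) \<in> sets (completion M)"
    using measurable_sets[OF measurable_completion[OF g] A] .
  have "AE x in completion M. x \<in> g -` A \<inter> space (completion M) \<longleftrightarrow> x \<in> f -` A \<inter> space (completion M)"
    using AE_completion[OF ae] by eventually_elim auto
  from completion.in_sets_AE[OF this gA]
  show "f -` A \<inter> space (completion M) \<in> sets (completion M)" by auto
qed (use f in auto)

lemma integral_completion_cong_AE:
  fixes g :: "'a \<Rightarrow> 'b::{banach, second_countable_topology}"
  assumes "g \<in> borel_measurable M" "AE x in M. f x = g x"
  shows "integral\<^sup>L (completion M) f = integral\<^sup>L M g"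
proof -
  have "integral\<^sup>L (completion M) f = integral\<^sup>L (completion M) g"
    using assms by (intro integral_cong_AE measurable_completion_cong_AE[OF assms(1)] measurable_completion AE_completion) auto
  thus ?thesis using assms by (simp add: integral_completion)
qed

lemma integrable_completion_cong_AE:
  fixes g :: "'a \<Rightarrow> 'b::{banach, second_countable_topology}"
  assumes "g \<in> borel_measurable M" "AE x in M. f x = g x"
  shows "integrable (completion M) f \<longleftrightarrow> integrable M g"
proof -
  have "integrable (completion M) f \<longleftrightarrow> integrable (completion M) g"
    using assms by (intro integrable_cong_AE measurable_completion_cong_AE[OF assms(1)] measurable_completion AE_completion) auto
  thus ?thesis using assms by (simp add: integrable_completion)
qed

lemma completion_ex_borel_measurable_complex:
  fixes f :: "'a \<Rightarrow> complex"
  assumes f: "f \<in> borel_measurable (completion M)"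
  shows "\<exists>g\<in>borel_measurable M. AE x in M. f x = g x"
proof -
  have "(\<lambda>x. Re (f x)) \<in> borel_measurable (completion M)" "(\<lambda>x. Im (f x)) \<in> borel_measurable (completion M)"
    using f by measurable
  then obtain r i where [measurable]: "r \<in> borel_measurable M" "i \<in> borel_measurable M"
    and ae: "AE x in M. Re (f x) = r x" "AE x in M. Im (f x) = i x"
    using completion_ex_borel_measurable_real[of "\<lambda>x. Re (f x)" M]
      completion_ex_borel_measurable_real[of "\<lambda>x. Im (f x)" M] by blast
  show ?thesis
  proof (intro bexI)
    show "AE x in M. f x = complex_of_real (r x) + \<i> * complex_of_real (i x)"
      using ae by eventually_elim (simp add: complex_eq_iff)
  qed measurable
qed

lemma ennreal_norm_integral_le:
  fixes f :: "'a \<Rightarrow> 'b::{banach, second_countable_topology}"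
  shows "ennreal (norm (integral\<^sup>L M f)) \<le> (\<integral>\<^sup>+x. ennreal (norm (f x)) \<partial>M)"
  by (cases "integrable M f") (auto simp: integral_norm_bound_ennreal not_integrable_integral_eq)

lemma nn_integral_lborel_translate:
  fixes f :: "'a::euclidean_space \<Rightarrow> ennreal"
  assumes [measurable]: "f \<in> borel_measurable borel"
  shows "(\<integral>\<^sup>+u. f (u - w) \<partial>lborel) = (\<integral>\<^sup>+u. f u \<partial>lborel)"
proof -
  have "(\<integral>\<^sup>+u. f u \<partial>lborel) = (\<integral>\<^sup>+u. f u \<partial>distr lborel borel ((+) (- w)))"
    by (simp add: lborel_distr_plus)
  also have "\<dots> = (\<integral>\<^sup>+u. f (u - w) \<partial>lborel)"
    by (subst nn_integral_distr) (auto simp: algebra_simps)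
  finally show ?thesis by simp
qed

lemma nn_integral_convolution:
  fixes f g :: "'a::euclidean_space \<Rightarrow> ennreal"
  assumes [measurable]: "f \<in> borel_measurable borel" "g \<in> borel_measurable borel"
  shows "(\<integral>\<^sup>+u. (\<integral>\<^sup>+w. f (u - w) * g w \<partial>lborel) \<partial>lborel)
    = (\<integral>\<^sup>+u. f u \<partial>lborel) * (\<integral>\<^sup>+w. g w \<partial>lborel)"
proof -
  have "(\<integral>\<^sup>+u. (\<integral>\<^sup>+w. f (u - w) * g w \<partial>lborel) \<partial>lborel)
      = (\<integral>\<^sup>+w. (\<integral>\<^sup>+u. f (u - w) * g w \<partial>lborel) \<partial>lborel)"
    by (rule lborel_pair.Fubini') measurable
  also have "\<dots> = (\<integral>\<^sup>+w. (\<integral>\<^sup>+u. f u \<partial>lborel) * g w \<partial>lborel)"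
    by (simp add: nn_integral_multc nn_integral_lborel_translate)
  finally show ?thesis by (simp add: nn_integral_cmult)
qed

text \<open>Both orders of the variables are needed: the norm integrates first over the second variable, the operator
first over the first one.\<close>
lemma AE_lborel_pairD:
  fixes P :: "real \<times> real \<Rightarrow> bool"
  assumes "AE x in lborel. P x"
  shows "AE x in lborel. AE y in lborel. P (x, y)" "AE y in lborel. AE x in lborel. P (x, y)"
proof -
  obtain N where N: "N \<in> null_sets lborel" "{x \<in> space lborel. \<not> P x} \<subseteq> N"
    using assms by (auto elim!: AE_E simp: null_sets_def)
  have "N \<in> sets (lborel \<Otimes>\<^sub>M lborel)" using N(1) unfolding lborel_prod by (rule null_setsD2)
  hence "space (lborel \<Otimes>\<^sub>M lborel) - N \<in> sets (lborel \<Otimes>\<^sub>M lborel)" by (rule sets.compl_sets)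
  hence N_compl: "{x \<in> space (lborel \<Otimes>\<^sub>M lborel). (fst x, snd x) \<notin> N} \<in> sets (lborel \<Otimes>\<^sub>M lborel)"
    by (simp add: set_diff_eq)
  have "AE x in lborel \<Otimes>\<^sub>M lborel. x \<notin> N" using N(1) by (simp add: lborel_prod AE_not_in)
  hence 1: "AE x in lborel. AE y in lborel. (x, y) \<notin> N" by (rule lborel_pair.AE_pair)
  have P: "P x" if "x \<notin> N" for x using N(2) that by auto
  from 1 show "AE x in lborel. AE y in lborel. P (x, y)"
    by eventually_elim (auto elim: eventually_mono intro: P)
  have "AE y in lborel. AE x in lborel. (x, y) \<notin> N"
    using 1 by (subst lborel_pair.AE_commute[OF N_compl, symmetric])
  thus "AE y in lborel. AE x in lborel. P (x, y)"
    by eventually_elim (auto elim: eventually_mono intro: P)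
qed

text \<open>Iterated integrals and Tonelli's theorem live on the product \<open>\<sigma>\<close>-algebra, whereas Lebesgue measurable
functions on the plane need not have measurable sections. Replacing \<open>d\<close> by a Borel function that agrees
with it almost everywhere removes the discrepancy.\<close>
lemma borel_representative:
  fixes d :: "real \<times> real \<Rightarrow> complex"
  assumes "d \<in> borel_measurable (lebesgue_on R)" and R: "R \<in> sets borel"
  obtains d' where "d' \<in> borel_measurable borel" "\<And>x. x \<notin> R \<Longrightarrow> d' x = 0"
    "AE x in lborel. x \<in> R \<longrightarrow> d x = d' x"
proof -
  have "(\<lambda>x. if x \<in> R then d x else 0) \<in> borel_measurable lebesgue"
    using assms by (intro borel_measurable_if_I) auto
  then obtain g where g: "g \<in> borel_measurable borel" "AE x in lborel. (if x \<in> R then d x else 0) = g x"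
    using completion_ex_borel_measurable_complex[of _ lborel] by auto
  show ?thesis
  proof (rule that[of "\<lambda>x. if x \<in> R then g x else 0"])
    show "(\<lambda>x. if x \<in> R then g x else 0) \<in> borel_measurable borel"
      using g(1) R by measurable
    show "AE x in lborel. x \<in> R \<longrightarrow> d x = (if x \<in> R then g x else 0)"
      using g(2) by eventually_elim auto
  qed auto
qed

lemma norm_L1_eq_nn_integral:
  assumes [measurable]: "d' \<in> borel_measurable borel"
    and zero: "\<And>x. x \<notin> {a1<..<a2} \<times> {b1<..<b2} \<Longrightarrow> d' x = 0"
    and ae: "AE x in lborel. x \<in> {a1<..<a2} \<times> {b1<..<b2} \<longrightarrow> d x = d' x"
  shows "norm_L1 a1 a2 b1 b2 d = (\<integral>\<^sup>+x. ennreal (norm (d' x)) \<partial>lborel)"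
proof -
  have "norm_L1 a1 a2 b1 b2 d = (\<integral>\<^sup>+z. (\<integral>\<^sup>+t. ennreal (norm (d' (z, t))) \<partial>lborel) \<partial>lborel)"
    unfolding norm_L1_def nn_integral_completion
  proof (rule nn_integral_cong_AE)
    show "AE z in lborel. (\<integral>\<^sup>+t\<in>{b1<..<b2}. ennreal (norm (d (z, t))) \<partial>lborel) * indicator {a1<..<a2} z
       = (\<integral>\<^sup>+t. ennreal (norm (d' (z, t))) \<partial>lborel)"
      using AE_lborel_pairD(1)[OF ae]
    proof eventually_elim
      case (elim z)
      show ?case
      proof (cases "z \<in> {a1<..<a2}")
        case True
        have "(\<integral>\<^sup>+t\<in>{b1<..<b2}. ennreal (norm (d (z, t))) \<partial>lborel) = (\<integral>\<^sup>+t. ennreal (norm (d' (z, t))) \<partial>lborel)"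
          by (intro nn_integral_cong_AE, use elim in eventually_elim)
            (use True zero in \<open>auto simp: indicator_def\<close>)
        thus ?thesis using True by simp
      next
        case False
        hence "d' (z, t) = 0" for t by (intro zero) auto
        thus ?thesis using False by simp
      qed
    qed
  qed
  also have "\<dots> = (\<integral>\<^sup>+x. ennreal (norm (d' x)) \<partial>(lborel \<Otimes>\<^sub>M lborel))"
    by (rule lborel.nn_integral_fst) (simp add: lborel_prod)
  finally show ?thesis by (simp add: lborel_prod)
qed

text \<open>Young's inequality \<open>\<parallel>k \<star> d\<parallel>\<^sub>1 \<le> \<parallel>k\<parallel>\<^sub>1 \<parallel>d\<parallel>\<^sub>1\<close> for a convolution truncated to the rectangle: for \<open>(z, t)\<close> and
\<open>(\<xi>, y)\<close> in the rectangle with \<open>\<xi> < z\<close> and \<open>y < t\<close>, the difference \<open>(z - \<xi>, t - y)\<close> lies in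
\<open>(0, a2 - a1) \<times> (0, b2 - b1)\<close>, so only the values of \<open>k\<close> there matter. The majorant \<open>C = \<bar>k\<bar> \<star> \<bar>d\<bar>\<close> has finite
integral, thus it is finite almost everywhere, and this gives the integrability of the integrand.\<close>
proposition volterra_convolution_L1:
  fixes k :: "real \<times> real \<Rightarrow> complex" and a1 a2 b1 b2 :: real
  defines "T \<equiv> \<lambda>d (z, t). LINT y:{b1<..<t}|lebesgue. LINT \<xi>:{a1<..<z}|lebesgue. k (z - \<xi>, t - y) * d (\<xi>, y)"
  defines "M \<equiv> \<integral>\<^sup>+x\<in>{0<..<a2 - a1} \<times> {0<..<b2 - b1}. ennreal (norm (k x)) \<partial>lborel"
  assumes k[measurable]: "k \<in> borel_measurable borel" and M: "M < \<infinity>" and d: "d \<in> space_L1 a1 a2 b1 b2"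
  shows "AE (z, t) in lebesgue_on ({a1<..<a2} \<times> {b1<..<b2}).
           set_integrable lebesgue ({a1<..<z} \<times> {b1<..<t}) (\<lambda>(\<xi>, y). k (z - \<xi>, t - y) * d (\<xi>, y))"
    and "T d \<in> space_L1 a1 a2 b1 b2"
    and "norm_L1 a1 a2 b1 b2 (T d) \<le> M * norm_L1 a1 a2 b1 b2 d"
proof -
  define R where "R = {a1<..<a2} \<times> {b1<..<b2}"
  have R[measurable]: "R \<in> sets borel" by (auto simp: R_def intro!: borel_open open_Times)
  have R': "R \<in> sets lebesgue" using R by auto
  have d_meas: "d \<in> borel_measurable (lebesgue_on R)" and d_fin: "norm_L1 a1 a2 b1 b2 d < \<infinity>"
    using d by (auto simp: space_L1_def R_def)
  obtain d' where d'[measurable]: "d' \<in> borel_measurable borel" and zero: "\<And>x. x \<notin> R \<Longrightarrow> d' x = 0"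
    and ae: "AE x in lborel. x \<in> R \<longrightarrow> d x = d' x"
    using borel_representative[OF d_meas R] by metis
  have norm_d: "norm_L1 a1 a2 b1 b2 d = (\<integral>\<^sup>+x. ennreal (norm (d' x)) \<partial>lborel)"
    by (rule norm_L1_eq_nn_integral) (use zero ae in \<open>auto simp: R_def\<close>)

  \<comment> \<open>the integrand with the Borel function \<open>d'\<close> in place of \<open>d\<close>; the conditions \<open>a1 < \<xi>\<close> and \<open>b1 < y\<close>
    are absorbed by \<open>d'\<close>, which vanishes off the rectangle\<close>
  define G where "G = (\<lambda>z t \<xi> y. if \<xi> < z \<and> y < t then k (z - \<xi>, t - y) * d' (\<xi>, y) else 0)"
  define S where "S = (\<lambda>(z, t). \<integral>y. (\<integral>\<xi>. G z t \<xi> y \<partial>lborel) \<partial>lborel)"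
  define k1 where "k1 = (\<lambda>x. ennreal (norm (k x)) * indicator ({0<..<a2 - a1} \<times> {0<..<b2 - b1}) x)"
  define C where "C = (\<lambda>u. \<integral>\<^sup>+w. k1 (u - w) * ennreal (norm (d' w)) \<partial>lborel)"
  have Q[measurable]: "{0<..<a2 - a1} \<times> {0<..<b2 - b1} \<in> sets borel"
    by (auto intro!: borel_open open_Times)
  have k1[measurable]: "k1 \<in> borel_measurable borel" by (simp add: k1_def)
  have C[measurable]: "C \<in> borel_measurable borel" unfolding C_def by measurable
  have C_int: "(\<integral>\<^sup>+u. C u \<partial>lborel) = M * norm_L1 a1 a2 b1 b2 d"
    unfolding C_def norm_d M_def k1_def[symmetric] by (rule nn_integral_convolution) auto
  have pair_borel: "(borel :: (real \<times> real) measure) = borel \<Otimes>\<^sub>M borel" by (rule borel_prod[symmetric])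
  have kp[measurable]: "k \<in> borel_measurable (borel \<Otimes>\<^sub>M borel)" using k by (simp add: borel_prod)
  have dp[measurable]: "d' \<in> borel_measurable (borel \<Otimes>\<^sub>M borel)" using d' by (simp add: borel_prod)
  have G_meas[measurable]: "(\<lambda>w. G z t (fst w) (snd w)) \<in> borel_measurable (borel \<Otimes>\<^sub>M borel)" for z t
    unfolding G_def by measurable
  have G_le: "ennreal (norm (G z t \<xi> y)) \<le> k1 ((z, t) - (\<xi>, y)) * ennreal (norm (d' (\<xi>, y)))"
    if "(z, t) \<in> R" for z t \<xi> y
    using that zero[of "(\<xi>, y)"]
    by (cases "(\<xi>, y) \<in> R") (auto simp: G_def k1_def R_def norm_mult ennreal_mult)

  have S_meas: "S \<in> borel_measurable borel"
    unfolding S_def G_def pair_borel by measurable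

  \<comment> \<open>almost every horizontal section of \<open>d\<close> agrees almost everywhere with that of \<open>d'\<close>, so the
    inner integrals agree for almost all \<open>y\<close>, and the outer ones for every \<open>x\<close>\<close>
  have T_eq: "T d x = S x" if "x \<in> R" for x
  proof -
    obtain z t where x: "x = (z, t)" by (cases x)
    have "T d x = (LINT y|lebesgue. indicator {b1<..<t} y *\<^sub>R (LINT \<xi>|lebesgue. indicator {a1<..<z} \<xi> *\<^sub>R (k (z - \<xi>, t - y) * d (\<xi>, y))))"
      by (simp add: T_def x set_lebesgue_integral_def)
    also have "\<dots> = (\<integral>y. (\<integral>\<xi>. G z t \<xi> y \<partial>lborel) \<partial>lborel)"
    proof (rule integral_completion_cong_AE)
      show "(\<lambda>y. \<integral>\<xi>. G z t \<xi> y \<partial>lborel) \<in> borel_measurable lborel"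
        unfolding G_def by measurable
      show "AE y in lborel. indicator {b1<..<t} y *\<^sub>R (LINT \<xi>|lebesgue. indicator {a1<..<z} \<xi> *\<^sub>R (k (z - \<xi>, t - y) * d (\<xi>, y)))
          = (\<integral>\<xi>. G z t \<xi> y \<partial>lborel)"
        using AE_lborel_pairD(2)[OF ae]
      proof eventually_elim
        case (elim y)
        show ?case
        proof (cases "y \<in> {b1<..<t}")
          case True
          have "(LINT \<xi>|lebesgue. indicator {a1<..<z} \<xi> *\<^sub>R (k (z - \<xi>, t - y) * d (\<xi>, y))) = (\<integral>\<xi>. G z t \<xi> y \<partial>lborel)"
          proof (rule integral_completion_cong_AE)
            show "(\<lambda>\<xi>. G z t \<xi> y) \<in> borel_measurable lborel" unfolding G_def by measurable
            show "AE \<xi> in lborel. indicator {a1<..<z} \<xi> *\<^sub>R (k (z - \<xi>, t - y) * d (\<xi>, y)) = G z t \<xi> y"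
              using elim
            proof eventually_elim
              case (elim \<xi>)
              thus ?case using True that zero[of "(\<xi>, y)"] by (auto simp: G_def R_def x indicator_def)
            qed
          qed
          thus ?thesis using True by simp
        next
          case False
          hence "G z t \<xi> y = 0" for \<xi> using zero[of "(\<xi>, y)"] by (auto simp: G_def R_def)
          thus ?thesis using False by simp
        qed
      qed
    qed
    finally show ?thesis by (simp add: S_def x)
  qed

  have S_le: "ennreal (norm (S x)) \<le> C x" if "x \<in> R" for x
  proof -
    obtain z t where x: "x = (z, t)" by (cases x)
    have "ennreal (norm (S x)) \<le> (\<integral>\<^sup>+y. ennreal (norm (\<integral>\<xi>. G z t \<xi> y \<partial>lborel)) \<partial>lborel)"
      by (simp add: S_def x ennreal_norm_integral_le)
    also have "\<dots> \<le> (\<integral>\<^sup>+y. (\<integral>\<^sup>+\<xi>. ennreal (norm (G z t \<xi> y)) \<partial>lborel) \<partial>lborel)"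
      by (intro nn_integral_mono ennreal_norm_integral_le)
    also have "\<dots> \<le> (\<integral>\<^sup>+y. (\<integral>\<^sup>+\<xi>. k1 (x - (\<xi>, y)) * ennreal (norm (d' (\<xi>, y))) \<partial>lborel) \<partial>lborel)"
      unfolding x by (intro nn_integral_mono G_le) (use that x in simp)
    also have "\<dots> = (\<integral>\<^sup>+w. k1 (x - w) * ennreal (norm (d' w)) \<partial>(lborel \<Otimes>\<^sub>M lborel))"
      by (rule lborel_pair.nn_integral_snd) (simp add: lborel_prod)
    finally show ?thesis by (simp add: C_def lborel_prod)
  qed

  have "norm_L1 a1 a2 b1 b2 (T d) = (\<integral>\<^sup>+x. ennreal (norm (if x \<in> R then S x else 0)) \<partial>lborel)"
  proof (rule norm_L1_eq_nn_integral)
    show "(\<lambda>x. if x \<in> R then S x else 0) \<in> borel_measurable borel" using S_meas by measurable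
  qed (use T_eq in \<open>auto simp: R_def\<close>)
  also have "\<dots> \<le> (\<integral>\<^sup>+x. C x \<partial>lborel)"
    by (intro nn_integral_mono) (use S_le in auto)
  finally show bound: "norm_L1 a1 a2 b1 b2 (T d) \<le> M * norm_L1 a1 a2 b1 b2 d" by (simp add: C_int)

  have "S \<in> borel_measurable (lebesgue_on R)"
    using S_meas by (intro measurable_restrict_space1 measurable_completion) auto
  hence "T d \<in> borel_measurable (lebesgue_on R)"
    by (rule measurable_cong[THEN iffD1, rotated]) (use T_eq in \<open>auto simp: space_restrict_space\<close>)
  thus "T d \<in> space_L1 a1 a2 b1 b2"
    using bound M d_fin by (auto simp: space_L1_def R_def ennreal_mult_less_top intro: le_less_trans)

  have "AE u in lborel. C u \<noteq> \<infinity>"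
    using M d_fin by (intro nn_integral_PInf_AE) (auto simp: C_int ennreal_mult_eq_top_iff)
  hence "AE u in lborel. u \<in> R \<longrightarrow> (case u of (z, t) \<Rightarrow>
           set_integrable lebesgue ({a1<..<z} \<times> {b1<..<t}) (\<lambda>(\<xi>, y). k (z - \<xi>, t - y) * d (\<xi>, y)))"
  proof eventually_elim
    case (elim u)
    obtain z t where u: "u = (z, t)" by (cases u)
    show ?case
    proof
      assume uR: "u \<in> R"
      have "integrable lborel (\<lambda>w. G z t (fst w) (snd w))"
      proof (rule integrableI_bounded)
        show "(\<lambda>w. G z t (fst w) (snd w)) \<in> borel_measurable lborel"
          using G_meas[of z t] by (simp add: borel_prod)
        have "(\<integral>\<^sup>+w. ennreal (norm (G z t (fst w) (snd w))) \<partial>lborel) \<le> C u"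
          unfolding C_def
        proof (rule nn_integral_mono)
          fix w :: "real \<times> real"
          show "ennreal (norm (G z t (fst w) (snd w))) \<le> k1 (u - w) * ennreal (norm (d' w))"
            using G_le[of z t "fst w" "snd w"] uR by (simp add: u)
        qed
        also have "\<dots> < \<infinity>" using elim by (simp add: less_top)
        finally show "(\<integral>\<^sup>+w. ennreal (norm (G z t (fst w) (snd w))) \<partial>lborel) < \<infinity>" .
      qed
      moreover have "AE w in lborel. indicator ({a1<..<z} \<times> {b1<..<t}) w *\<^sub>R (case w of (\<xi>, y) \<Rightarrow> k (z - \<xi>, t - y) * d (\<xi>, y))
          = G z t (fst w) (snd w)"
        using ae
      proof eventually_elim
        case (elim w)
        thus ?case using uR zero[of w] by (cases w) (auto simp: G_def R_def u indicator_def)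
      qed
      ultimately show "case u of (z, t) \<Rightarrow>
           set_integrable lebesgue ({a1<..<z} \<times> {b1<..<t}) (\<lambda>(\<xi>, y). k (z - \<xi>, t - y) * d (\<xi>, y))"
        unfolding set_integrable_def u using G_meas[of z t]
        by (subst prod.case, subst integrable_completion_cong_AE) (auto simp: borel_prod)
    qed
  qed
  thus "AE (z, t) in lebesgue_on ({a1<..<a2} \<times> {b1<..<b2}).
           set_integrable lebesgue ({a1<..<z} \<times> {b1<..<t}) (\<lambda>(\<xi>, y). k (z - \<xi>, t - y) * d (\<xi>, y))"
    using R' by (subst AE_restrict_space_iff) (auto simp: R_def AE_completion_iff split_beta)
qed

section \<open>The integral of the kernel\<close>

text \<open>If the series of norms diverges, the right-hand side is \<open>\<infinity>\<close>. So the kernel can be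
estimated termwise before the convergence of its series is settled.\<close>
lemma ennreal_norm_suminf_le:
  fixes f :: "nat \<Rightarrow> 'a::banach"
  shows "ennreal (norm (suminf f)) \<le> (\<Sum>i. ennreal (norm (f i)))"
proof (cases "(\<Sum>i. ennreal (norm (f i))) = top")
  case False
  hence "summable (\<lambda>i. norm (f i))" by (intro summable_suminf_not_top) auto
  hence "ennreal (norm (suminf f)) \<le> ennreal (\<Sum>i. norm (f i))"
    by (intro ennreal_leI summable_norm)
  also have "\<dots> = (\<Sum>i. ennreal (norm (f i)))"
    using False by (intro suminf_ennreal[symmetric]) auto
  finally show ?thesis .
qed simp

lemma ennreal_suminf_commute:
  fixes f :: "nat \<Rightarrow> nat \<Rightarrow> ennreal"
  shows "(\<Sum>i. \<Sum>j. f i j) = (\<Sum>j. \<Sum>i. f i j)"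
proof -
  have "(\<Sum>i. \<Sum>j. f i j) = (\<Sum>i. \<integral>\<^sup>+j. f i j \<partial>count_space UNIV)"
    by (simp add: nn_integral_count_space_nat)
  also have "\<dots> = (\<integral>\<^sup>+j. (\<Sum>i. f i j) \<partial>count_space UNIV)"
    by (rule nn_integral_suminf[symmetric]) simp
  finally show ?thesis by (simp add: nn_integral_count_space_nat)
qed

lemma nn_integral_powr_interval:
  fixes a h :: real
  assumes "a > 0" "h \<ge> 0"
  shows "(\<integral>\<^sup>+x\<in>{0<..<h}. ennreal (x powr (a - 1)) \<partial>lborel) = ennreal (h powr a / a)"
proof -
  have "((\<lambda>x. x powr (a - 1)) has_integral (h powr a / a)) {0..h}"
    using has_integral_powr_from_0[of "a - 1" h] assms by simp
  hence "((\<lambda>x. x powr (a - 1)) has_integral (h powr a / a)) {0<..<h}"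
    using has_integral_Icc_iff_Ioo by blast
  hence "((\<lambda>x. if x \<in> {0<..<h} then x powr (a - 1) else 0) has_integral (h powr a / a)) UNIV"
    by (simp only: has_integral_restrict_UNIV)
  hence "(\<integral>\<^sup>+x. ennreal (if x \<in> {0<..<h} then x powr (a - 1) else 0) \<partial>lborel) = ennreal (h powr a / a)"
    by (intro nn_integral_has_integral_lborel) auto
  also have "(\<integral>\<^sup>+x. ennreal (if x \<in> {0<..<h} then x powr (a - 1) else 0) \<partial>lborel)
      = (\<integral>\<^sup>+x\<in>{0<..<h}. ennreal (x powr (a - 1)) \<partial>lborel)"
    by (intro nn_integral_cong) (auto simp: indicator_def)
  finally show ?thesis .
qed

text \<open>The operator is convolution with the restriction of this function to the quadrant \<open>x > 0\<close>, \<open>s > 0\<close>.\<close>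
definition konhauser_kernel ::
  "complex \<Rightarrow> complex \<Rightarrow> complex \<Rightarrow> complex \<Rightarrow> complex \<Rightarrow> complex \<Rightarrow>
   complex \<Rightarrow> complex \<Rightarrow> complex \<Rightarrow> complex \<Rightarrow> complex \<Rightarrow> real \<times> real \<Rightarrow> complex" where
  "konhauser_kernel g1 g2 g3 g4 g5 g6 p q v w1 c2 = (\<lambda>(x, s).
     complex_of_real s powr (q - 1) * complex_of_real x powr (p - 1)
       * konhauser_ML g1 g2 g3 g4 g5 g6 p q v (w1 * complex_of_real x) c2 s)"

lemma konhauser_kernel_measurable:
  "konhauser_kernel g1 g2 g3 g4 g5 g6 p q v w1 c2 \<in> borel_measurable borel"
proof -
  have "konhauser_kernel g1 g2 g3 g4 g5 g6 p q v w1 c2 \<in> borel_measurable (borel \<Otimes>\<^sub>M borel)"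
    unfolding konhauser_kernel_def konhauser_ML_def by measurable
  thus ?thesis by (simp add: borel_prod)
qed

lemma nn_integral_powr_rectangle:
  fixes \<alpha> \<beta> A B :: real
  assumes "\<alpha> > 0" "\<beta> > 0" "A \<ge> 0" "B \<ge> 0"
  shows "(\<integral>\<^sup>+(x, s)\<in>{0<..<A} \<times> {0<..<B}. ennreal (x powr (\<alpha> - 1) * s powr (\<beta> - 1)) \<partial>lborel)
    = ennreal (A powr \<alpha> / \<alpha> * (B powr \<beta> / \<beta>))"
proof -
  have "(\<integral>\<^sup>+(x, s)\<in>{0<..<A} \<times> {0<..<B}. ennreal (x powr (\<alpha> - 1) * s powr (\<beta> - 1)) \<partial>lborel)
      = (\<integral>\<^sup>+u. (ennreal (fst u powr (\<alpha> - 1)) * indicator {0<..<A} (fst u)) *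
              (ennreal (snd u powr (\<beta> - 1)) * indicator {0<..<B} (snd u)) \<partial>(lborel \<Otimes>\<^sub>M lborel))"
    unfolding lborel_prod
    by (intro nn_integral_cong) (auto simp: indicator_def ennreal_mult)
  also have "\<dots> = (\<integral>\<^sup>+x. (\<integral>\<^sup>+s. (ennreal (x powr (\<alpha> - 1)) * indicator {0<..<A} x) *
              (ennreal (s powr (\<beta> - 1)) * indicator {0<..<B} s) \<partial>lborel) \<partial>lborel)"
    by (subst lborel.nn_integral_fst[symmetric]) simp_all
  also have "\<dots> = (\<integral>\<^sup>+x\<in>{0<..<A}. ennreal (x powr (\<alpha> - 1)) \<partial>lborel) *
      (\<integral>\<^sup>+s\<in>{0<..<B}. ennreal (s powr (\<beta> - 1)) \<partial>lborel)"
    by (simp add: nn_integral_cmult nn_integral_multc)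
  finally show ?thesis
    using assms by (simp add: nn_integral_powr_interval flip: ennreal_mult)
qed

text \<open>The terms of the kernel have norm \<open>c n l * x powr (Re p + l - 1) * s powr (Re q + n * Re v - 1)\<close>. Integrating
them one by one over the rectangle produces the factors \<open>1 / (Re p + l)\<close> and
\<open>1 / (Re q + n * Re v)\<close> of the constant, and the powers of the side lengths. All sums are taken in
\<open>[0, \<infinity>]\<close>, where they commute with each other and with the integral.\<close>
lemma konhauser_kernel_L1_le:
  fixes p q v g1 g2 g3 g4 g5 g6 w1 c2 :: complex
  assumes "Re p > 0" "Re q > 0" "Re v > 0" "a1 < a2" "b1 < b2"
  shows "(\<integral>\<^sup>+x\<in>{0<..<a2 - a1} \<times> {0<..<b2 - b1}.
            ennreal (norm (konhauser_kernel g1 g2 g3 g4 g5 g6 p q v w1 c2 x)) \<partial>lborel)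
          \<le> konhauser_bound g1 g2 g3 g4 g5 g6 p q v w1 c2 a1 a2 b1 b2"
proof -
  define A B where "A = a2 - a1" and "B = b2 - b1"
  have AB: "A > 0" "B > 0" using assms by (auto simp: A_def B_def)
  define c where "c = (\<lambda>n l. (norm (pochhammer g1 (2 * l)) * norm (pochhammer g2 (l + n)) * norm (pochhammer g3 l)) /
        (norm (pochhammer g4 l) * norm (pochhammer g5 l) * norm (pochhammer g6 l)) *
        ((norm w1 ^ l * norm c2 ^ n) /
         (norm (Gamma (p + of_nat l)) * norm (Gamma (q + v * of_nat n)) * fact l * fact n)))"
  have c: "c n l \<ge> 0" for n l by (simp add: c_def)
  define a b where "a = (\<lambda>l. Re p + real l)" and "b = (\<lambda>n. Re q + Re v * real n)"
  have ab: "a l > 0" "b n > 0" for l n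
    using assms by (auto simp: a_def b_def intro: add_pos_nonneg)
  define f where "f = (\<lambda>n l (x, s). ennreal (c n l) * (ennreal (x powr (a l - 1) * s powr (b n - 1))
      * indicator ({0<..<A} \<times> {0<..<B}) (x, s)))"
  have f_meas: "f n l \<in> borel_measurable lborel" for n l
  proof -
    have "{0<..<A} \<times> {0<..<B} \<in> sets (borel \<Otimes>\<^sub>M borel)" by auto
    hence "f n l \<in> borel_measurable (borel \<Otimes>\<^sub>M borel)" unfolding f_def by measurable
    thus ?thesis by (simp add: borel_prod)
  qed
  have kernel_le: "ennreal (norm (konhauser_kernel g1 g2 g3 g4 g5 g6 p q v w1 c2 u)) *
      indicator ({0<..<A} \<times> {0<..<B}) u \<le> (\<Sum>l. \<Sum>n. f n l u)" for u
  proof (cases "u \<in> {0<..<A} \<times> {0<..<B}")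
    case True
    then obtain x s where u: "u = (x, s)" and xs: "x > 0" "s > 0" by auto
    define \<tau> where "\<tau> = (\<lambda>l n.
        ((-1) ^ l * pochhammer g1 (2 * l) * pochhammer g2 (l + n) * pochhammer g3 l
           * (w1 * complex_of_real x) ^ l * (c2 ^ n * complex_of_real s powr (v * of_nat n))) /
        (pochhammer g4 l * pochhammer g5 l * pochhammer g6 l
           * Gamma (p + of_nat l) * Gamma (q + v * of_nat n) * fact n * fact l))"
    have series_le: "ennreal (norm (konhauser_ML g1 g2 g3 g4 g5 g6 p q v (w1 * complex_of_real x) c2 s))
        \<le> (\<Sum>l. \<Sum>n. ennreal (norm (\<tau> l n)))"
    proof -
      have "ennreal (norm (konhauser_ML g1 g2 g3 g4 g5 g6 p q v (w1 * complex_of_real x) c2 s))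
          \<le> (\<Sum>l. ennreal (norm (\<Sum>n. \<tau> l n)))"
        unfolding konhauser_ML_def \<tau>_def by (rule ennreal_norm_suminf_le)
      also have "\<dots> \<le> (\<Sum>l. \<Sum>n. ennreal (norm (\<tau> l n)))"
        by (intro suminf_le summableI ennreal_norm_suminf_le)
      finally show ?thesis .
    qed
    define m where "m = norm (complex_of_real s powr (q - 1) * complex_of_real x powr (p - 1))"
    have term_eq: "ennreal m * ennreal (norm (\<tau> l n)) = f n l u" for l n
    proof -
      have m: "m = s powr (Re q - 1) * x powr (Re p - 1)"
        using xs by (simp add: m_def norm_mult norm_powr_real_powr)
      have "norm (\<tau> l n) = c n l * (x ^ l * s powr (Re v * real n))"
        using xs by (simp add: \<tau>_def c_def norm_mult norm_divide norm_power norm_powr_real_powr power_mult_distrib mult_ac)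
      moreover have "x powr (a l - 1) = x powr (Re p - 1) * x ^ l"
        using xs by (simp add: a_def powr_add[symmetric] powr_realpow[symmetric] algebra_simps)
      moreover have "s powr (b n - 1) = s powr (Re q - 1) * s powr (Re v * real n)"
        by (simp add: b_def powr_add[symmetric] algebra_simps)
      ultimately have "m * norm (\<tau> l n) = c n l * (x powr (a l - 1) * s powr (b n - 1))"
        by (simp add: m)
      hence "ennreal m * ennreal (norm (\<tau> l n)) = ennreal (c n l) * ennreal (x powr (a l - 1) * s powr (b n - 1))"
        using c[of n l] by (simp add: m_def flip: ennreal_mult)
      thus ?thesis using True by (simp add: f_def u)
    qed
    have "ennreal (norm (konhauser_kernel g1 g2 g3 g4 g5 g6 p q v w1 c2 u))
        = ennreal m * ennreal (norm (konhauser_ML g1 g2 g3 g4 g5 g6 p q v (w1 * complex_of_real x) c2 s))"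
      by (simp add: konhauser_kernel_def u m_def norm_mult ennreal_mult)
    also have "\<dots> \<le> ennreal m * (\<Sum>l. \<Sum>n. ennreal (norm (\<tau> l n)))"
      by (intro mult_left_mono series_le) simp
    also have "\<dots> = (\<Sum>l. \<Sum>n. f n l u)"
      by (simp add: term_eq flip: ennreal_suminf_cmult)
    finally show ?thesis using True by simp
  qed simp
  have "(\<integral>\<^sup>+u\<in>{0<..<A} \<times> {0<..<B}.
            ennreal (norm (konhauser_kernel g1 g2 g3 g4 g5 g6 p q v w1 c2 u)) \<partial>lborel)
        \<le> (\<integral>\<^sup>+u. (\<Sum>l. \<Sum>n. f n l u) \<partial>lborel)"
    by (intro nn_integral_mono kernel_le)
  also have "\<dots> = (\<Sum>l. \<Sum>n. \<integral>\<^sup>+u. f n l u \<partial>lborel)"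
    using f_meas by (simp add: nn_integral_suminf)
  also have "\<dots> = (\<Sum>n. \<Sum>l. \<integral>\<^sup>+u. f n l u \<partial>lborel)"
    by (rule ennreal_suminf_commute)
  also have "\<dots> = (\<Sum>n. \<Sum>l. ennreal (A powr Re p * B powr Re q) * ennreal (
        (norm (pochhammer g1 (2 * l)) * norm (pochhammer g2 (l + n)) * norm (pochhammer g3 l)) /
        (norm (pochhammer g4 l) * norm (pochhammer g5 l) * norm (pochhammer g6 l)) *
        ((norm (w1 * complex_of_real A) ^ l *
          norm (c2 * complex_of_real B powr v) ^ n) /
         (norm (Gamma (p + of_nat l)) * norm (Gamma (q + v * of_nat n)) *
          (Re p + real l) * (Re q + Re v * real n) * fact l * fact n))))"
    (is "_ = (\<Sum>n. \<Sum>l. _ * ennreal (?t n l))")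
  proof (intro suminf_cong)
    fix n l
    have rect: "{0<..<A} \<times> {0<..<B} \<in> sets (borel :: (real \<times> real) measure)"
      by (intro borel_open open_Times) auto
    have "(\<integral>\<^sup>+u. f n l u \<partial>lborel) = ennreal (c n l) * ennreal (A powr a l / a l * (B powr b n / b n))"
    proof -
      have "(\<lambda>(x, s). ennreal (x powr (a l - 1) * s powr (b n - 1)) * indicator ({0<..<A} \<times> {0<..<B}) (x, s))
          \<in> borel_measurable (borel \<Otimes>\<^sub>M borel)"
        using rect by (subst (asm) borel_prod[symmetric]) measurable
      hence "(\<integral>\<^sup>+u. f n l u \<partial>lborel) = ennreal (c n l) *
          (\<integral>\<^sup>+(x, s)\<in>{0<..<A} \<times> {0<..<B}. ennreal (x powr (a l - 1) * s powr (b n - 1)) \<partial>lborel)"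
        unfolding f_def
        by (subst nn_integral_cmult[symmetric]) (auto simp: borel_prod case_prod_beta' intro!: nn_integral_cong)
      thus ?thesis using ab AB by (simp add: nn_integral_powr_rectangle)
    qed
    also have "\<dots> = ennreal (c n l * (A powr a l / a l * (B powr b n / b n)))"
      using c[of n l] ab(1)[of l] ab(2)[of n] by (subst ennreal_mult) auto
    also have "c n l * (A powr a l / a l * (B powr b n / b n)) = (A powr Re p * B powr Re q) * ?t n l"
    proof -
      have A: "A powr a l = A powr Re p * A ^ l"
        using AB by (simp add: a_def powr_add powr_realpow)
      have B: "B powr b n = B powr Re q * (B powr Re v) ^ n"
        using AB by (simp add: b_def powr_add powr_powr flip: powr_realpow)
      have "norm (complex_of_real B powr v) = B powr Re v"
        using AB by (simp add: norm_powr_real_powr)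
      thus ?thesis
        unfolding A B c_def using AB
        by (simp add: norm_mult power_mult_distrib a_def b_def divide_inverse mult_ac)
    qed
    finally show "(\<integral>\<^sup>+u. f n l u \<partial>lborel) = ennreal (A powr Re p * B powr Re q) * ennreal (?t n l)"
      by (subst ennreal_mult'[symmetric]) simp_all
  qed
  also have "\<dots> = konhauser_bound g1 g2 g3 g4 g5 g6 p q v w1 c2 a1 a2 b1 b2"
    by (simp add: konhauser_bound_def A_def B_def)
  finally show ?thesis by (simp add: A_def B_def)
qed

lemma konhauser_integrand_eq_kernel:
  "konhauser_integrand g1 g2 g3 g4 g5 g6 p q v w1 c2 d z t
     = (\<lambda>(\<xi>, y). konhauser_kernel g1 g2 g3 g4 g5 g6 p q v w1 c2 (z - \<xi>, t - y) * d (\<xi>, y))"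
  by (simp add: konhauser_integrand_def konhauser_kernel_def fun_eq_iff)

section \<open>Boundedness of the operator\<close>

theorem theorem55:
  fixes p q v g1 g2 g3 g4 g5 g6 w1 w2 c2 :: complex
    and a1 a2 b1 b2 :: real
  assumes "Re p > 0" and "Re q > 0" and "Re v > 0"
    and "g4 \<notin> \<int>\<^sub>\<le>\<^sub>0" and "g5 \<notin> \<int>\<^sub>\<le>\<^sub>0" and "g6 \<notin> \<int>\<^sub>\<le>\<^sub>0"
    and "cpower_value w2 v c2"
    and "a1 < a2" and "b1 < b2"
  shows "0 < konhauser_bound g1 g2 g3 g4 g5 g6 p q v w1 c2 a1 a2 b1 b2 \<and>
    konhauser_bound g1 g2 g3 g4 g5 g6 p q v w1 c2 a1 a2 b1 b2 < \<infinity> \<and>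
    (\<forall>d \<in> space_L1 a1 a2 b1 b2.
       (AE (z, t) in lebesgue_on ({a1<..<a2} \<times> {b1<..<b2}).
          set_integrable lebesgue ({a1<..<z} \<times> {b1<..<t})
            (konhauser_integrand g1 g2 g3 g4 g5 g6 p q v w1 c2 d z t)) \<and>
       konhauser_operator g1 g2 g3 g4 g5 g6 p q v w1 c2 a1 b1 d \<in> space_L1 a1 a2 b1 b2 \<and>
       norm_L1 a1 a2 b1 b2 (konhauser_operator g1 g2 g3 g4 g5 g6 p q v w1 c2 a1 b1 d)
         \<le> konhauser_bound g1 g2 g3 g4 g5 g6 p q v w1 c2 a1 a2 b1 b2 * norm_L1 a1 a2 b1 b2 d)"
proof (intro conjI ballI)
  let ?k = "konhauser_kernel g1 g2 g3 g4 g5 g6 p q v w1 c2"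
  let ?M = "konhauser_bound g1 g2 g3 g4 g5 g6 p q v w1 c2 a1 a2 b1 b2"
  let ?N = "\<integral>\<^sup>+x\<in>{0<..<a2 - a1} \<times> {0<..<b2 - b1}. ennreal (norm (?k x)) \<partial>lborel"
  show "0 < ?M" using assms by (intro konhauser_bound_pos)
  show fin: "?M < \<infinity>" using assms by (intro konhauser_bound_finite)
  have N_le: "?N \<le> ?M" using assms by (intro konhauser_kernel_L1_le)
  have N: "?N < \<infinity>" using N_le fin by (rule le_less_trans)
  fix d assume d: "d \<in> space_L1 a1 a2 b1 b2"
  note young = volterra_convolution_L1[OF konhauser_kernel_measurable N d]
  have operator_eq: "konhauser_operator g1 g2 g3 g4 g5 g6 p q v w1 c2 a1 b1 d =
      (\<lambda>(z, t). LINT y:{b1<..<t}|lebesgue. LINT \<xi>:{a1<..<z}|lebesgue. ?k (z - \<xi>, t - y) * d (\<xi>, y))"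
    by (simp add: konhauser_operator_def konhauser_integrand_eq_kernel)
  show "AE (z, t) in lebesgue_on ({a1<..<a2} \<times> {b1<..<b2}).
          set_integrable lebesgue ({a1<..<z} \<times> {b1<..<t})
            (konhauser_integrand g1 g2 g3 g4 g5 g6 p q v w1 c2 d z t)"
    unfolding konhauser_integrand_eq_kernel by (rule young(1))
  show "konhauser_operator g1 g2 g3 g4 g5 g6 p q v w1 c2 a1 b1 d \<in> space_L1 a1 a2 b1 b2"
    unfolding operator_eq by (rule young(2))
  have "norm_L1 a1 a2 b1 b2 (konhauser_operator g1 g2 g3 g4 g5 g6 p q v w1 c2 a1 b1 d)
      \<le> ?N * norm_L1 a1 a2 b1 b2 d"
    unfolding operator_eq by (rule young(3))
  also have "\<dots> \<le> ?M * norm_L1 a1 a2 b1 b2 d" by (intro mult_right_mono N_le) simp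
  finally show "norm_L1 a1 a2 b1 b2 (konhauser_operator g1 g2 g3 g4 g5 g6 p q v w1 c2 a1 b1 d)
      \<le> ?M * norm_L1 a1 a2 b1 b2 d" .
qed

end
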